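(* Let $\mathcal{B}$ be a real Banach space having a pre-dual space $\mathcal{B}_*$, let $\nu_1,\dots,\nu_n\in\mathcal{B}_*$ be linearly independent, let $\mathbf{y}=[y_1,\dots,y_n]\in\mathbb{R}^n\setminus\{\mathbf{0}\}$, and let $\mathcal{M}_{\mathbf{y}}:=\{f\in\mathcal{B}:\langle\nu_j,f\rangle_{\mathcal{B}}=y_j,\ j=1,\dots,n\}$. Then $$\inf\{\|f\|_{\mathcal{B}}:f\in\mathcal{M}_{\mathbf{y}}\}=\sup\Bigl\{\sum_{j=1}^nc_jy_j:\mathbf{c}\in\mathbb{R}^n,\ \Bigl\|\sum_{j=1}^nc_j\nu_j\Bigr\|_{\mathcal{B}_*}=1\Bigr\}.$$
   Context: A Banach space $\mathcal{B}$ has a pre-dual space $\mathcal{B}_*$ if $\mathcal{B}_*$ is a Banach space with $(\mathcal{B}_* )^*=\mathcal{B}$ (isometric identification). Elements $\nu\in\mathcal{B}_*$ act on $\mathcal{B}$ by $\langle\nu,f\rangle_{\mathcal{B}}=\langle f,\nu\rangle_{\mathcal{B}_*}=f(\nu)$. *)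

theory Defs
  imports "HOL-Analysis.Analysis"
begin

text \<open>
  The type \<open>'p \<Rightarrow>\<^sub>L real\<close> with its operator norm is the dual of \<open>'p\<close>. The identification of
  \<open>'b\<close> with this dual is an explicit map \<open>\<Phi>\<close>, a surjective linear isometry.
\<close>

definition predual_identification ::
    "('b::banach \<Rightarrow> ('p::banach \<Rightarrow>\<^sub>L real)) \<Rightarrow> bool" where
  "predual_identification \<Phi> \<longleftrightarrow>
     linear \<Phi> \<and> (\<forall>f. norm (\<Phi> f) = norm f) \<and> surj \<Phi>"

definition predual_pairing ::
    "('b::banach \<Rightarrow> ('p::banach \<Rightarrow>\<^sub>L real)) \<Rightarrow> 'p \<Rightarrow> 'b \<Rightarrow> real" where
  "predual_pairing \<Phi> \<nu> f = blinfun_apply (\<Phi> f) \<nu>"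

definition interpolation_set ::
    "('b::banach \<Rightarrow> ('p::banach \<Rightarrow>\<^sub>L real)) \<Rightarrow> ('n::finite \<Rightarrow> 'p) \<Rightarrow> real ^ 'n \<Rightarrow> 'b set" where
  "interpolation_set \<Phi> \<nu> y = {f. \<forall>j. predual_pairing \<Phi> (\<nu> j) f = y $ j}"

text \<open>
  Linear independence of a family, not only of its range: repeated members are excluded.
\<close>

definition independent_family :: "('i \<Rightarrow> 'v::real_vector) \<Rightarrow> bool" where
  "independent_family \<nu> \<longleftrightarrow> inj \<nu> \<and> independent (range \<nu>)"

end

theory Submission
  imports Defs
begin

text \<open>
  Write \<open>L c = (\<Sum>j. c\<^sub>j \<nu>\<^sub>j)\<close>. Every interpolant \<open>f\<close> satisfies
  \<open>c \<bullet> y = \<langle>L c, f\<rangle> \<le> \<parallel>f\<parallel>\<close> whenever \<open>\<parallel>L c\<parallel> = 1\<close>, so the supremum \<open>K\<close> is at most the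
  infimum. Conversely \<open>c \<bullet> y \<le> K \<parallel>L c\<parallel>\<close> for all \<open>c\<close>, and this is Helly's condition for a
  functional of norm at most \<open>K\<close> with the value \<open>y\<^sub>j\<close> at each \<open>\<nu>\<^sub>j\<close>
  (\<open>Helly_interpolation\<close>). As \<open>\<B>\<close> is the whole dual of \<open>\<B>\<^sub>*\<close>, that functional is an
  interpolant; the infimum is therefore attained and equals \<open>K\<close>. Linear independence makes \<open>L\<close>
  injective on a finite-dimensional space, hence bounded below, which is what makes \<open>K\<close> finite.

  Helly's condition leads to the functional through the Hahn--Banach theorem, proved here in its sublinear form:
  every sublinear functional dominates a linear one. The single construction behind both is
  \<open>lowered p P\<close>, which lowers a sublinear \<open>p\<close> along a cone \<open>P\<close> of pairs \<open>(v, r)\<close> with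
  \<open>r \<le> p v\<close>, so that any linear functional below the result is at least \<open>r\<close> at \<open>v\<close>. With the ray
  through \<open>(x, p x)\<close> it shows that a minimal sublinear functional is linear; with the subspace of
  all \<open>(L c, c \<bullet> y)\<close> it forces the interpolation conditions.
\<close>

section \<open>Sublinear functionals and the Hahn--Banach theorem\<close>

definition sublinear :: "('v::real_vector \<Rightarrow> real) \<Rightarrow> bool" where
  "sublinear p \<longleftrightarrow> (\<forall>x z. p (x + z) \<le> p x + p z) \<and> (\<forall>t\<ge>0. \<forall>x. p (t *\<^sub>R x) = t * p x)"

lemma sublinear_add: "sublinear p \<Longrightarrow> p (x + z) \<le> p x + p z"
  and sublinear_scale: "sublinear p \<Longrightarrow> t \<ge> 0 \<Longrightarrow> p (t *\<^sub>R x) = t * p x"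
  by (auto simp: sublinear_def)

lemma sublinear_zero: "sublinear p \<Longrightarrow> p 0 = 0"
  using sublinear_scale[of p 0 0] by simp

lemma sublinear_minus: "sublinear p \<Longrightarrow> - p (- x) \<le> p x"
  using sublinear_add[of p x "- x"] sublinear_zero[of p] by simp

text \<open>
  Homogeneity may be checked as an inequality, since scaling by \<open>1 / t\<close> gives the reverse one.
\<close>

lemma sublinearI:
  assumes add: "\<And>x z. p (x + z) \<le> p x + p z"
    and scale: "\<And>t x. t > 0 \<Longrightarrow> p (t *\<^sub>R x) \<le> t * p x"
    and zero: "p 0 = 0"
  shows "sublinear p"
  unfolding sublinear_def
proof (intro conjI allI impI add)
  fix t :: real and x assume "t \<ge> 0"
  show "p (t *\<^sub>R x) = t * p x"
  proof (cases "t = 0")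
    case False
    with \<open>t \<ge> 0\<close> have t: "t > 0" by simp
    have "p x \<le> (1 / t) * p (t *\<^sub>R x)"
      using scale[of "1 / t" "t *\<^sub>R x"] t by simp
    then have "t * p x \<le> p (t *\<^sub>R x)"
      using t by (simp add: field_simps)
    with scale[OF t, of x] show ?thesis by simp
  qed (simp add: zero)
qed

definition pair_cone :: "('v::real_vector \<times> real) set \<Rightarrow> bool" where
  "pair_cone P \<longleftrightarrow> 0 \<in> P \<and> (\<forall>a\<in>P. \<forall>b\<in>P. a + b \<in> P) \<and> (\<forall>t>0. \<forall>a\<in>P. t *\<^sub>R a \<in> P)"

definition lowered :: "('v::real_vector \<Rightarrow> real) \<Rightarrow> ('v \<times> real) set \<Rightarrow> 'v \<Rightarrow> real" where
  "lowered p P x = (INF a\<in>P. p (x + fst a) - snd a)"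

context
  fixes p :: "'v::real_vector \<Rightarrow> real" and P :: "('v \<times> real) set"
  assumes p: "sublinear p" and P: "pair_cone P" and dom: "\<And>v r. (v, r) \<in> P \<Longrightarrow> r \<le> p v"
begin

text \<open>
  The infimum is finite because \<open>r \<le> p v\<close> gives
  \<open>p (x + v) - r \<ge> p v - p (- x) - r \<ge> - p (- x)\<close>.
\<close>

lemma lowered_le: "a \<in> P \<Longrightarrow> lowered p P x \<le> p (x + fst a) - snd a"
  unfolding lowered_def
proof (rule cINF_lower)
  show "bdd_below ((\<lambda>a. p (x + fst a) - snd a) ` P)"
  proof (rule bdd_belowI2)
    fix a assume "a \<in> P"
    then have "snd a \<le> p (fst a)" using dom[of "fst a" "snd a"] by simp
    moreover have "p (fst a) \<le> p (x + fst a) + p (- x)"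
      using sublinear_add[OF p, of "x + fst a" "- x"] by simp
    ultimately show "- p (- x) \<le> p (x + fst a) - snd a" by simp
  qed
qed

lemma lowered_greatest: "(\<And>a. a \<in> P \<Longrightarrow> m \<le> p (x + fst a) - snd a) \<Longrightarrow> m \<le> lowered p P x"
  unfolding lowered_def using P by (intro cINF_greatest) (auto simp: pair_cone_def)

lemma lowered_le_original: "lowered p P x \<le> p x"
  using lowered_le[of 0 x] P by (simp add: pair_cone_def)

lemma lowered_at_minus:
  assumes "(v, r) \<in> P"
  shows "lowered p P (- v) \<le> - r"
  using lowered_le[OF assms, of "- v"] sublinear_zero[OF p] by simp

lemma sublinear_lowered: "sublinear (lowered p P)"
proof (rule sublinearI)
  fix x z
  have sum_le: "lowered p P (x + z) \<le> (p (x + fst a) - snd a) + (p (z + fst b) - snd b)"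
    if "a \<in> P" "b \<in> P" for a b
  proof -
    have "a + b \<in> P" using P that by (simp add: pair_cone_def)
    then have "lowered p P (x + z) \<le> p ((x + fst a) + (z + fst b)) - (snd a + snd b)"
      using lowered_le[of "a + b" "x + z"] by (simp add: algebra_simps)
    with sublinear_add[OF p, of "x + fst a" "z + fst b"] show ?thesis by simp
  qed
  have "lowered p P (x + z) - (p (x + fst a) - snd a) \<le> lowered p P z" if "a \<in> P" for a
    using sum_le[OF that] by (intro lowered_greatest) (simp add: algebra_simps)
  then have "lowered p P (x + z) - lowered p P z \<le> lowered p P x"
    by (intro lowered_greatest) (simp add: algebra_simps)
  then show "lowered p P (x + z) \<le> lowered p P x + lowered p P z" by simp
next
  fix t :: real and x assume t: "t > 0"
  have "lowered p P (t *\<^sub>R x) / t \<le> lowered p P x"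
  proof (rule lowered_greatest)
    fix a assume "a \<in> P"
    then have "t *\<^sub>R a \<in> P" using P t by (simp add: pair_cone_def)
    then have "lowered p P (t *\<^sub>R x) \<le> p (t *\<^sub>R (x + fst a)) - t * snd a"
      using lowered_le[of "t *\<^sub>R a" "t *\<^sub>R x"] by (simp add: scaleR_add_right)
    also have "\<dots> = t * (p (x + fst a) - snd a)"
      using sublinear_scale[OF p, of t "x + fst a"] t by (simp add: right_diff_distrib)
    finally show "lowered p P (t *\<^sub>R x) / t \<le> p (x + fst a) - snd a"
      using t by (simp add: pos_divide_le_eq mult.commute)
  qed
  then show "lowered p P (t *\<^sub>R x) \<le> t * lowered p P x"
    using t by (simp add: pos_divide_le_eq mult.commute)
next
  have "0 \<le> lowered p P 0"
    by (rule lowered_greatest) (use dom in auto)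
  with lowered_le_original[of 0] sublinear_zero[OF p] show "lowered p P 0 = 0" by simp
qed

end

text \<open>
  Lowering \<open>q\<close> along the ray through \<open>(x, q x)\<close> changes nothing when \<open>q\<close> is minimal, so the value
  at \<open>- x\<close> is already at most \<open>- q x\<close>. Hence \<open>q\<close> is odd, and an odd sublinear functional is linear.
\<close>

lemma minimal_sublinear_imp_linear:
  assumes q: "sublinear q"
    and minimal: "\<And>q'. sublinear q' \<Longrightarrow> q' \<le> q \<Longrightarrow> q' = q"
  shows "linear q"
proof -
  have odd: "q (- x) = - q x" for x
  proof -
    define P where "P = {(t *\<^sub>R x, t * q x) | t. t \<ge> 0}"
    have P: "pair_cone P"
      unfolding pair_cone_def
    proof (intro conjI ballI allI impI)
      show "0 \<in> P" unfolding P_def by (auto simp: zero_prod_def intro!: exI[of _ 0])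
    next
      fix a b assume "a \<in> P" "b \<in> P"
      then obtain s t where "s \<ge> 0" "a = (s *\<^sub>R x, s * q x)" "t \<ge> 0" "b = (t *\<^sub>R x, t * q x)"
        unfolding P_def by auto
      then have "s + t \<ge> 0" "a + b = ((s + t) *\<^sub>R x, (s + t) * q x)"
        by (auto simp: algebra_simps)
      then show "a + b \<in> P" unfolding P_def by blast
    next
      fix s :: real and a assume "s > 0" "a \<in> P"
      then obtain t where "t \<ge> 0" "a = (t *\<^sub>R x, t * q x)" unfolding P_def by auto
      with \<open>s > 0\<close> have "s * t \<ge> 0" "s *\<^sub>R a = ((s * t) *\<^sub>R x, (s * t) * q x)" by auto
      then show "s *\<^sub>R a \<in> P" unfolding P_def by blast
    qed
    have dom: "r \<le> q v" if "(v, r) \<in> P" for v r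
      using that sublinear_scale[OF q] by (auto simp: P_def)
    have "(x, q x) \<in> P" unfolding P_def by (auto intro!: exI[of _ 1])
    moreover have "lowered q P = q"
      using sublinear_lowered[OF q P dom] lowered_le_original[OF q P dom]
      by (intro minimal) (auto simp: le_fun_def)
    ultimately have "q (- x) \<le> - q x"
      using lowered_at_minus[OF q P dom, of x "q x"] by simp
    with sublinear_minus[OF q, of x] show ?thesis by simp
  qed
  show ?thesis
  proof (rule linearI)
    fix x z
    have "q (- x + - z) \<le> q (- x) + q (- z)" by (rule sublinear_add[OF q])
    moreover have "q (- x + - z) = - q (x + z)" using odd[of "x + z"] by simp
    ultimately show "q (x + z) = q x + q z"
      using sublinear_add[OF q, of x z] odd by simp
  next
    fix t x
    show "q (t *\<^sub>R x) = t *\<^sub>R q x"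
    proof (cases "t \<ge> 0")
      case False
      then have "q ((- t) *\<^sub>R x) = - t * q x" by (intro sublinear_scale[OF q]) simp
      with odd[of "t *\<^sub>R x"] show ?thesis by simp
    qed (simp add: sublinear_scale[OF q])
  qed
qed

text \<open>
  The pointwise infimum is finite because every member \<open>q\<close> satisfies \<open>q x \<ge> - q (- x) \<ge> - p (- x)\<close>.
  Subadditivity needs the chain: for two members used at \<open>x\<close> and at \<open>z\<close>, the smaller
  one serves at both points.
\<close>

lemma sublinear_Inf_chain:
  assumes "C \<noteq> {}"
    and sub: "\<And>q. q \<in> C \<Longrightarrow> sublinear q"
    and below: "\<And>q. q \<in> C \<Longrightarrow> q \<le> p"
    and chain: "\<And>q q'. q \<in> C \<Longrightarrow> q' \<in> C \<Longrightarrow> q \<le> q' \<or> q' \<le> q"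
  shows "sublinear (\<lambda>x. INF q\<in>C. q x)" and "\<And>q x. q \<in> C \<Longrightarrow> (INF q\<in>C. q x) \<le> q x"
proof -
  define m where "m x = (INF q\<in>C. q x)" for x
  have lower: "m x \<le> q x" if "q \<in> C" for q x
    unfolding m_def
  proof (rule cINF_lower[OF _ that])
    show "bdd_below ((\<lambda>q. q x) ` C)"
    proof (rule bdd_belowI2)
      fix q assume "q \<in> C"
      then have "- q (- x) \<le> q x" "q (- x) \<le> p (- x)"
        using sublinear_minus[OF sub] below by (auto simp: le_fun_def)
      then show "- p (- x) \<le> q x" by simp
    qed
  qed
  then show "(INF q\<in>C. q x) \<le> q x" if "q \<in> C" for q x
    using that by (simp add: m_def)
  have greatest: "b \<le> m x" if "\<And>q. q \<in> C \<Longrightarrow> b \<le> q x" for b x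
    unfolding m_def using assms(1) that by (rule cINF_greatest)
  have "sublinear m"
  proof (rule sublinearI)
    fix x z
    have sum_le: "m (x + z) \<le> q x + q' z" if qs: "q \<in> C" "q' \<in> C" for q q'
    proof -
      obtain r where r: "r \<in> C" "r \<le> q" "r \<le> q'" using chain[OF qs] qs by blast
      then have "m (x + z) \<le> r x + r z"
        using lower[of r "x + z"] sublinear_add[OF sub, of r x z] by linarith
      also have "\<dots> \<le> q x + q' z" using r by (intro add_mono) (auto simp: le_fun_def)
      finally show ?thesis .
    qed
    have "m (x + z) - q x \<le> m z" if "q \<in> C" for q
      using sum_le[OF that] by (intro greatest) (simp add: algebra_simps)
    then have "m (x + z) - m z \<le> m x"
      by (intro greatest) (simp add: algebra_simps)
    then show "m (x + z) \<le> m x + m z" by simp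
  next
    fix t :: real and x assume t: "t > 0"
    have "m (t *\<^sub>R x) / t \<le> m x"
    proof (rule greatest)
      fix q assume "q \<in> C"
      then show "m (t *\<^sub>R x) / t \<le> q x"
        using lower[of q "t *\<^sub>R x"] sublinear_scale[OF sub, of q t x] t
        by (simp add: pos_divide_le_eq mult.commute)
    qed
    then show "m (t *\<^sub>R x) \<le> t * m x" using t by (simp add: pos_divide_le_eq mult.commute)
  next
    have "(\<lambda>q. q 0) ` C = {0}"
      using assms(1) sublinear_zero[OF sub] by (auto simp: image_iff)
    then show "m 0 = 0" by (simp add: m_def)
  qed
  then show "sublinear (\<lambda>x. INF q\<in>C. q x)" by (simp add: m_def[abs_def])
qed

theorem sublinear_dominates_linear:
  fixes p :: "'v::real_vector \<Rightarrow> real"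
  assumes p: "sublinear p"
  obtains g where "linear g" "g \<le> p"
proof -
  define A where "A = {q. sublinear q \<and> q \<le> p}"
  have "\<exists>q\<in>A. \<forall>q'\<in>A. q' \<le> q \<longrightarrow> q' = q"
  proof (rule predicate_Zorn)
    show "partial_order_on A (relation_of (\<lambda>q q'. q' \<le> q) A)"
      by (rule partial_order_on_relation_ofI) auto
  next
    fix C assume "C \<in> Chains (relation_of (\<lambda>q q'. q' \<le> q) A)"
    then have C: "\<And>q q'. q \<in> C \<Longrightarrow> q' \<in> C \<Longrightarrow> q \<in> A \<and> (q \<le> q' \<or> q' \<le> q)"
      by (auto simp: Chains_def relation_of_def)
    show "\<exists>u\<in>A. \<forall>q\<in>C. u \<le> q"
    proof (cases "C = {}")
      case True
      then show ?thesis using p by (auto simp: A_def)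
    next
      case False
      then obtain q0 where q0: "q0 \<in> C" by blast
      have sub: "\<And>q. q \<in> C \<Longrightarrow> sublinear q" and below: "\<And>q. q \<in> C \<Longrightarrow> q \<le> p"
        using C by (auto simp: A_def)
      have chain: "\<And>q q'. q \<in> C \<Longrightarrow> q' \<in> C \<Longrightarrow> q \<le> q' \<or> q' \<le> q" using C by blast
      let ?m = "\<lambda>x. INF q\<in>C. q x"
      have lower: "?m \<le> q" if "q \<in> C" for q
        using sublinear_Inf_chain(2)[OF False sub below chain that] by (auto simp: le_fun_def)
      have "?m \<le> p"
        by (rule order_trans[OF lower[OF q0] below[OF q0]])
      with sublinear_Inf_chain(1)[OF False sub below chain] have "?m \<in> A"
        by (simp add: A_def)
      with lower show ?thesis by blast
    qed
  qed
  then obtain q where q: "sublinear q" "q \<le> p"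
    and minimal: "\<And>q'. sublinear q' \<Longrightarrow> q' \<le> p \<Longrightarrow> q' \<le> q \<Longrightarrow> q' = q"
    by (auto simp: A_def)
  have "linear q"
    by (rule minimal_sublinear_imp_linear[OF q(1)]) (use minimal q(2) order_trans in blast)
  with q(2) show thesis by (rule that[rotated])
qed

section \<open>Interpolation by bounded functionals\<close>

text \<open>
  \<open>K \<parallel>x\<parallel>\<close> is lowered along the subspace of all \<open>(L c, c \<bullet> y)\<close>, where \<open>L c = (\<Sum>j. c\<^sub>j \<nu>\<^sub>j)\<close>. A linear
  functional \<open>g\<close> below the result has \<open>g (L c) \<ge> c \<bullet> y\<close> for every \<open>c\<close>, and replacing \<open>c\<close> by \<open>- c\<close>
  turns this into equality.
\<close>

theorem Helly_interpolation:
  fixes \<nu> :: "'n::finite \<Rightarrow> 'p::real_normed_vector" and y :: "real ^ 'n"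
  assumes K: "K \<ge> 0"
    and Helly: "\<And>c :: real ^ 'n. c \<bullet> y \<le> K * norm (\<Sum>j\<in>UNIV. c $ j *\<^sub>R \<nu> j)"
  obtains g :: "'p \<Rightarrow>\<^sub>L real" where "norm g \<le> K" "\<And>j. blinfun_apply g (\<nu> j) = y $ j"
proof -
  define L where "L c = (\<Sum>j\<in>UNIV. c $ j *\<^sub>R \<nu> j)" for c :: "real ^ 'n"
  have L_add: "L (c + d) = L c + L d" for c d
    by (simp add: L_def scaleR_add_left sum.distrib)
  have L_scale: "L (t *\<^sub>R c) = t *\<^sub>R L c" for t c
    by (simp add: L_def scaleR_sum_right)
  have L_axis: "L (axis j 1) = \<nu> j" for j
  proof -
    have "L (axis j 1) = (\<Sum>i\<in>UNIV. if i = j then \<nu> i else 0)"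
      unfolding L_def by (intro sum.cong) (auto simp: axis_def)
    then show ?thesis by simp
  qed
  let ?p = "\<lambda>x::'p. K * norm x"
  define P where "P = range (\<lambda>c. (L c, c \<bullet> y))"
  have p: "sublinear ?p"
    unfolding sublinear_def
    using K by (auto simp: norm_triangle_ineq mult_left_mono simp flip: distrib_left)
  have P: "pair_cone P"
    unfolding pair_cone_def
  proof (intro conjI ballI allI impI)
    have "(0::'p \<times> real) = (L 0, 0 \<bullet> y)" by (simp add: L_def zero_prod_def)
    then show "0 \<in> P" unfolding P_def by blast
  next
    fix a b assume "a \<in> P" "b \<in> P"
    then obtain c d where "a = (L c, c \<bullet> y)" "b = (L d, d \<bullet> y)" unfolding P_def by auto
    then have "a + b = (L (c + d), (c + d) \<bullet> y)" by (simp add: L_add inner_add_left)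
    then show "a + b \<in> P" unfolding P_def by blast
  next
    fix t :: real and a assume "a \<in> P"
    then obtain c where "a = (L c, c \<bullet> y)" unfolding P_def by auto
    then have "t *\<^sub>R a = (L (t *\<^sub>R c), (t *\<^sub>R c) \<bullet> y)" by (simp add: L_scale)
    then show "t *\<^sub>R a \<in> P" unfolding P_def by blast
  qed
  have dom: "r \<le> ?p v" if "(v, r) \<in> P" for v r
    using that Helly by (auto simp: P_def L_def)
  obtain g where g: "linear g" "g \<le> lowered ?p P"
    using sublinear_dominates_linear[OF sublinear_lowered[OF p P dom]] by blast
  have g_le: "g x \<le> K * norm x" for x
    using g(2) lowered_le_original[OF p P dom, of x] by (auto simp: le_fun_def intro: order_trans)
  have g_bound: "norm (g x) \<le> K * norm x" for x
    using g_le[of x] g_le[of "- x"] linear_neg[OF g(1), of x] by (simp add: abs_le_iff)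
  have "bounded_linear g"
    using g(1) g_bound by (intro linear_conv_bounded_linear[THEN iffD1] bounded_linear_intro[of g K])
      (auto simp: linear_add linear_scale mult.commute)
  then have app: "blinfun_apply (Blinfun g) = g" by (rule bounded_linear_Blinfun_apply)
  have g_ge: "c \<bullet> y \<le> g (L c)" for c
  proof -
    have "g (- L c) \<le> lowered ?p P (- L c)" using g(2) by (simp add: le_fun_def)
    also have "\<dots> \<le> - (c \<bullet> y)"
      by (rule lowered_at_minus[OF p P dom]) (auto simp: P_def)
    finally show ?thesis using linear_neg[OF g(1)] by simp
  qed
  have "g (L c) = c \<bullet> y" for c
    using g_ge[of c] g_ge[of "- c"] L_scale[of "- 1" c] linear_neg[OF g(1)] by simp
  from this[of "axis _ 1"] have "g (\<nu> j) = y $ j" for j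
    by (simp add: L_axis inner_axis')
  moreover have "norm (Blinfun g) \<le> K"
    using K g_bound by (intro norm_blinfun_bound) (simp_all add: app)
  ultimately show thesis using that[of "Blinfun g"] by (simp add: app)
qed

section \<open>The dual formula for the minimal interpolation norm\<close>

lemma independent_family_sum_eq_0:
  fixes \<nu> :: "'n::finite \<Rightarrow> 'v::real_vector" and c :: "real ^ 'n"
  assumes "independent_family \<nu>" and "(\<Sum>j\<in>UNIV. c $ j *\<^sub>R \<nu> j) = 0"
  shows "c = 0"
proof -
  have inj: "inj \<nu>" and ind: "independent (range \<nu>)"
    using assms(1) by (auto simp: independent_family_def)
  have "(\<Sum>v\<in>range \<nu>. c $ (inv \<nu> v) *\<^sub>R v) = 0"
    using assms(2) inj by (simp add: sum.reindex)
  then have "c $ (inv \<nu> v) = 0" if "v \<in> range \<nu>" for v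
    using independentD[OF ind _ subset_refl _ that, of "\<lambda>v. c $ (inv \<nu> v)"] by simp
  then have "c $ (inv \<nu> (\<nu> j)) = 0" for j by blast
  then show ?thesis using inj by (simp add: vec_eq_iff)
qed

text \<open>
  The coefficient norm and the norm of the combination are comparable because the latter has a
  positive minimum on the compact unit sphere of coefficients.
\<close>

lemma independent_family_bounded_below:
  fixes \<nu> :: "'n::finite \<Rightarrow> 'v::real_normed_vector"
  assumes "independent_family \<nu>"
  obtains m where "m > 0" "\<And>c :: real ^ 'n. m * norm c \<le> norm (\<Sum>j\<in>UNIV. c $ j *\<^sub>R \<nu> j)"
proof -
  let ?N = "\<lambda>c :: real ^ 'n. norm (\<Sum>j\<in>UNIV. c $ j *\<^sub>R \<nu> j)"
  have "sphere (0 :: real ^ 'n) 1 \<noteq> {}"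
    by simp
  moreover have "continuous_on (sphere 0 1) ?N"
    by (intro continuous_intros)
  ultimately obtain d where d: "d \<in> sphere 0 1" "\<And>c. c \<in> sphere 0 1 \<Longrightarrow> ?N d \<le> ?N c"
    using continuous_attains_inf[OF compact_sphere, of "0 :: real ^ 'n" 1 ?N] by blast
  show thesis
  proof
    show "?N d > 0"
      using d(1) independent_family_sum_eq_0[OF assms, of d] by auto
  next
    fix c :: "real ^ 'n"
    show "?N d * norm c \<le> ?N c"
    proof (cases "c = 0")
      case False
      have "(\<Sum>j\<in>UNIV. (c /\<^sub>R norm c) $ j *\<^sub>R \<nu> j) = (\<Sum>j\<in>UNIV. c $ j *\<^sub>R \<nu> j) /\<^sub>R norm c"
        by (simp add: scaleR_sum_right)
      then have "?N (c /\<^sub>R norm c) = ?N c / norm c" by (simp add: divide_inverse mult.commute)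
      with d(2)[of "c /\<^sub>R norm c"] False show ?thesis by (simp add: pos_le_divide_eq)
    qed simp
  qed
qed

theorem proposition36:
  fixes \<Phi> :: "'b::banach \<Rightarrow> ('p::banach \<Rightarrow>\<^sub>L real)"
    and \<nu> :: "'n::finite \<Rightarrow> 'p"
    and y :: "real ^ 'n"
  assumes "predual_identification \<Phi>"
    and "independent_family \<nu>"
    and "y \<noteq> 0"
  shows "Inf {norm f | f. f \<in> interpolation_set \<Phi> \<nu> y} =
         Sup {(\<Sum>j\<in>UNIV. c $ j * y $ j) | c :: real ^ 'n.
                norm (\<Sum>j\<in>UNIV. c $ j *\<^sub>R \<nu> j) = 1}"
proof -
  define L where "L c = (\<Sum>j\<in>UNIV. c $ j *\<^sub>R \<nu> j)" for c :: "real ^ 'n"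
  define S where "S = {c \<bullet> y | c. norm (L c) = 1}"
  have S_eq: "{(\<Sum>j\<in>UNIV. c $ j * y $ j) | c :: real ^ 'n.
                 norm (\<Sum>j\<in>UNIV. c $ j *\<^sub>R \<nu> j) = 1} = S"
    by (simp add: S_def L_def inner_vec_def)
  have L_scale: "L (t *\<^sub>R c) = t *\<^sub>R L c" for t c
    by (simp add: L_def scaleR_sum_right)
  have L_inj: "c = 0" if "L c = 0" for c
    using independent_family_sum_eq_0[OF assms(2)] that by (simp add: L_def)
  have normalised: "(c \<bullet> y) / norm (L c) \<in> S" if "c \<noteq> 0" for c
  proof -
    have "L c \<noteq> 0" using L_inj that by blast
    then have "norm (L (c /\<^sub>R norm (L c))) = 1" by (simp add: L_scale)
    moreover have "(c /\<^sub>R norm (L c)) \<bullet> y = (c \<bullet> y) / norm (L c)"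
      by (simp add: divide_inverse mult.commute)
    ultimately show ?thesis unfolding S_def by force
  qed
  have bdd: "bdd_above S"
  proof -
    obtain m where m: "m > 0" "\<And>c. m * norm c \<le> norm (L c)"
      using independent_family_bounded_below[OF assms(2)] unfolding L_def by metis
    have "c \<bullet> y \<le> norm y / m" if "norm (L c) = 1" for c
    proof -
      have "c \<bullet> y \<le> norm c * norm y" by (rule norm_cauchy_schwarz)
      also have "\<dots> \<le> (1 / m) * norm y"
        using m(2)[of c] m(1) that by (intro mult_right_mono) (simp_all add: field_simps)
      finally show ?thesis by simp
    qed
    then show ?thesis unfolding S_def by (intro bdd_aboveI) auto
  qed
  define K where "K = Sup S"
  have y_in_S: "(y \<bullet> y) / norm (L y) \<in> S" by (rule normalised[OF assms(3)])
  then have "(y \<bullet> y) / norm (L y) \<le> K"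
    unfolding K_def using bdd by (rule cSup_upper)
  then have K: "K \<ge> 0" by (rule order_trans[rotated]) simp
  have Helly: "c \<bullet> y \<le> K * norm (\<Sum>j\<in>UNIV. c $ j *\<^sub>R \<nu> j)" for c
  proof (cases "c = 0")
    case False
    then have "(c \<bullet> y) / norm (L c) \<le> K"
      unfolding K_def using normalised bdd by (blast intro: cSup_upper)
    moreover have "norm (L c) > 0" using L_inj False by auto
    ultimately show ?thesis by (simp add: pos_divide_le_eq L_def)
  qed simp
  obtain g :: "'p \<Rightarrow>\<^sub>L real" where g: "norm g \<le> K" "\<And>j. blinfun_apply g (\<nu> j) = y $ j"
    using Helly_interpolation[OF K Helly] by blast
  obtain f where f: "\<Phi> f = g"
    using assms(1) unfolding predual_identification_def by (metis surjD)
  have iso: "norm (\<Phi> h) = norm h" for h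
    using assms(1) by (simp add: predual_identification_def)
  have f_in: "f \<in> interpolation_set \<Phi> \<nu> y"
    by (simp add: interpolation_set_def predual_pairing_def f g(2))
  have lower: "K \<le> norm h" if h: "h \<in> interpolation_set \<Phi> \<nu> y" for h
    unfolding K_def
  proof (rule cSup_least)
    show "S \<noteq> {}" using y_in_S by blast
  next
    fix s assume "s \<in> S"
    then obtain c where c: "s = c \<bullet> y" "norm (L c) = 1" unfolding S_def by blast
    have "s = blinfun_apply (\<Phi> h) (L c)"
      using h unfolding c(1) L_def
      by (simp add: interpolation_set_def predual_pairing_def inner_vec_def
          blinfun.sum_right blinfun.scaleR_right)
    also have "\<dots> \<le> norm (\<Phi> h) * norm (L c)"
      using norm_blinfun[of "\<Phi> h" "L c"] by simp
    finally show "s \<le> norm h" using c(2) iso by simp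
  qed
  have "norm f = K" using g(1) iso[of f] f lower[OF f_in] by simp
  with f_in lower have "Inf {norm f | f. f \<in> interpolation_set \<Phi> \<nu> y} = K"
    by (intro cInf_eq_minimum) auto
  then show ?thesis unfolding S_eq K_def .
qed

end
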